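(* Let $S$ be a set and $\to\subseteq S\times S$ a binary relation. Let $P,P',Q,Q'\subseteq S$, $F,F'\subseteq S\times S$ and $c_0,c_1:S\to\mathbb{N}$. If $\mathrm{EnsuresN}_{\to}(P,Q,F,c_0)$ and $\mathrm{EnsuresN}_{\to}(P',Q',F',c_1)$ hold, then $\mathrm{Ensures2}_{\to}(P\times P',Q\times Q',F\otimes F',c_0,c_1)$ holds, where $F\otimes F'=\{((s_0,s_1),(s_0',s_1'))\mid (s_0,s_0')\in F\wedge(s_1,s_1')\in F'\}$.
   Context: For $n\in\mathbb{N}$, $\to^n$ denotes the $n$-fold composition of $\to$, with $\to^0$ the identity relation on $S$. For $n\in\mathbb{N}$ and $Q\subseteq S$, $\mathrm{EvN}_{\to}(n,Q)=\{s\in S\mid (\forall s'.\ s\to^n s'\Rightarrow s'\in Q)\wedge(\forall s'\,\forall l<n.\ s\to^l s'\Rightarrow\exists s''.\ s'\to s'')\}$. $\mathrm{EnsuresN}_{\to}(P,Q,F,c)$ (for $P,Q\subseteq S$, $F\subseteq S\times S$, $c:S\to\mathbb{N}$) means: for all $s\in P$, $s\in\mathrm{EvN}_{\to}(c(s),\{s'\mid s'\in Q\wedge(s,s')\in F\})$. For $P,Q\subseteq S\times S$, $F\subseteq(S\times S)\times(S\times S)$ and $c_0,c_1:S\to\mathbb{N}$, $\mathrm{Ensures2}_{\to}(P,Q,F,c_0,c_1)$ means: for all $(s_0,s_1)\in P$, $s_0\in\mathrm{EvN}_{\to}\big(c_0(s_0),\{s_0'\mid s_1\in\mathrm{EvN}_{\to}(c_1(s_1),\{s_1'\mid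 (s_0',s_1')\in Q\wedge((s_0,s_1),(s_0',s_1'))\in F\})\}\big)$. *)

theory Defs
  imports Main
begin

(* The state space is an explicit carrier S. The power r ^^ 0 is the identity on
   the whole type; on states of S this is the same as the identity on S. Step-count
   functions are total on the type, but the definitions only use their values on
   elements of the precondition. *)

definition EvN :: "'a set \<Rightarrow> 'a rel \<Rightarrow> nat \<Rightarrow> 'a set \<Rightarrow> 'a set" where
  "EvN S r n Q =
     {s \<in> S. (\<forall>s'. (s, s') \<in> r ^^ n \<longrightarrow> s' \<in> Q) \<and>
             (\<forall>s'. \<forall>l<n. (s, s') \<in> r ^^ l \<longrightarrow> (\<exists>s''. (s', s'') \<in> r))}"

definition EnsuresN ::
  "'a set \<Rightarrow> 'a rel \<Rightarrow> 'a set \<Rightarrow> 'a set \<Rightarrow> 'a rel \<Rightarrow> ('a \<Rightarrow> nat) \<Rightarrow> bool" where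
  "EnsuresN S r P Q F c \<longleftrightarrow>
     (\<forall>s\<in>P. s \<in> EvN S r (c s) {s'. s' \<in> Q \<and> (s, s') \<in> F})"

definition Ensures2 ::
  "'a set \<Rightarrow> 'a rel \<Rightarrow> ('a \<times> 'a) set \<Rightarrow> ('a \<times> 'a) set \<Rightarrow> ('a \<times> 'a) rel \<Rightarrow>
   ('a \<Rightarrow> nat) \<Rightarrow> ('a \<Rightarrow> nat) \<Rightarrow> bool" where
  "Ensures2 S r P Q F c\<^sub>0 c\<^sub>1 \<longleftrightarrow>
     (\<forall>(s\<^sub>0, s\<^sub>1)\<in>P.
        s\<^sub>0 \<in> EvN S r (c\<^sub>0 s\<^sub>0)
          {s\<^sub>0' \<in> S. s\<^sub>1 \<in> EvN S r (c\<^sub>1 s\<^sub>1)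
             {s\<^sub>1' \<in> S. (s\<^sub>0', s\<^sub>1') \<in> Q \<and> ((s\<^sub>0, s\<^sub>1), (s\<^sub>0', s\<^sub>1')) \<in> F}})"

definition frame_prod :: "'a rel \<Rightarrow> 'a rel \<Rightarrow> ('a \<times> 'a) rel" (infixr "\<otimes>" 70) where
  "F \<otimes> F' = {((s\<^sub>0, s\<^sub>1), (s\<^sub>0', s\<^sub>1')) | s\<^sub>0 s\<^sub>1 s\<^sub>0' s\<^sub>1'. (s\<^sub>0, s\<^sub>0') \<in> F \<and> (s\<^sub>1, s\<^sub>1') \<in> F'}"

end

theory Submission
  imports Defs
begin

text \<open>The nesting in \<open>Ensures2\<close> couples the two runs only through the target
  sets: the inner \<open>EvN\<close> always starts at \<open>s\<^sub>1\<close>, wherever the outer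
  run has ended. Each hypothesis therefore supplies its own \<open>EvN\<close> fact, with step
  counts and progress conditions unchanged, and only the targets have to be enlarged. This is
  monotonicity of \<open>EvN\<close> in its last argument (\<open>EvN_mono\<close>), applied once at
  each level; no induction on steps arises.\<close>

lemma EvN_mono: "s \<in> EvN S r n A \<Longrightarrow> A \<subseteq> B \<Longrightarrow> s \<in> EvN S r n B"
  unfolding EvN_def by blast

theorem theorem3:
  fixes S :: "'a set" and r :: "'a rel"
    and P P' Q Q' :: "'a set" and F F' :: "'a rel"
    and c\<^sub>0 c\<^sub>1 :: "'a \<Rightarrow> nat"
  assumes "r \<subseteq> S \<times> S"
    and "P \<subseteq> S" and "P' \<subseteq> S" and "Q \<subseteq> S" and "Q' \<subseteq> S"
    and "F \<subseteq> S \<times> S" and "F' \<subseteq> S \<times> S"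
    and "EnsuresN S r P Q F c\<^sub>0"
    and "EnsuresN S r P' Q' F' c\<^sub>1"
  shows "Ensures2 S r (P \<times> P') (Q \<times> Q') (F \<otimes> F') c\<^sub>0 c\<^sub>1"
  unfolding Ensures2_def
proof clarify
  fix s\<^sub>0 s\<^sub>1
  assume "s\<^sub>0 \<in> P" "s\<^sub>1 \<in> P'"
  then have E\<^sub>0: "s\<^sub>0 \<in> EvN S r (c\<^sub>0 s\<^sub>0) {s'. s' \<in> Q \<and> (s\<^sub>0, s') \<in> F}"
    and E\<^sub>1: "s\<^sub>1 \<in> EvN S r (c\<^sub>1 s\<^sub>1) {s'. s' \<in> Q' \<and> (s\<^sub>1, s') \<in> F'}"
    using assms(8,9) unfolding EnsuresN_def by blast+
  show "s\<^sub>0 \<in> EvN S r (c\<^sub>0 s\<^sub>0)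
      {s\<^sub>0' \<in> S. s\<^sub>1 \<in> EvN S r (c\<^sub>1 s\<^sub>1)
        {s\<^sub>1' \<in> S. (s\<^sub>0', s\<^sub>1') \<in> Q \<times> Q' \<and> ((s\<^sub>0, s\<^sub>1), (s\<^sub>0', s\<^sub>1')) \<in> F \<otimes> F'}}"
  \<comment> \<open>What remains is an inclusion of targets: any \<open>s\<^sub>0'\<close> that
    meets the first postcondition and frame must lie in the outer target, which contains the whole
    claim about \<open>s\<^sub>1\<close>.\<close>
  proof (rule EvN_mono[OF E\<^sub>0], clarify, intro conjI)
    fix s\<^sub>0'
    assume "s\<^sub>0' \<in> Q" "(s\<^sub>0, s\<^sub>0') \<in> F"
    then show "s\<^sub>0' \<in> S"
      using assms(4) by blast
    \<comment> \<open>With \<open>s\<^sub>0'\<close> fixed, its membership in \<open>Q\<close> and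
      its \<open>F\<close>-relation to \<open>s\<^sub>0\<close> are constants that give the first
      half of each product condition; the target in \<open>E\<^sub>1\<close> gives the second half,
      and \<open>Q' \<subseteq> S\<close> the carrier condition.\<close>
    show "s\<^sub>1 \<in> EvN S r (c\<^sub>1 s\<^sub>1)
        {s\<^sub>1' \<in> S. (s\<^sub>0', s\<^sub>1') \<in> Q \<times> Q' \<and> ((s\<^sub>0, s\<^sub>1), (s\<^sub>0', s\<^sub>1')) \<in> F \<otimes> F'}"
      using \<open>s\<^sub>0' \<in> Q\<close> \<open>(s\<^sub>0, s\<^sub>0') \<in> F\<close> assms(5)
      by (intro EvN_mono[OF E\<^sub>1]) (auto simp: frame_prod_def)
  qed
qed

end
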